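(* The kissing number in three dimensions is $k(3)=12$. Equivalently, the maximal number of points that can be placed on the unit sphere $\mathbf{S}^2\subset\mathbb{R}^3$ such that the angular separation between any two distinct points is at least $60^\circ$ equals $12$.
   Context: The kissing number $k(d)$ is the largest number of nonoverlapping unit balls in $\mathbb{R}^d$ that can all touch a given unit ball. Equivalently, it is the largest number of points on the unit sphere $\mathbf{S}^{d-1}$ with pairwise angular (spherical) distance at least $60^\circ$. *)

theory Defs
  imports "HOL-Analysis.Analysis"
begin

definition sph_dist :: "'a::real_inner \<Rightarrow> 'a \<Rightarrow> real" where
  "sph_dist x y = arccos (x \<bullet> y)"

definition kissing_config :: "'a::real_inner set \<Rightarrow> bool" where
  "kissing_config S \<longleftrightarrow> finite S \<and> S \<subseteq> sphere 0 1 \<and>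
     (\<forall>x\<in>S. \<forall>y\<in>S. x \<noteq> y \<longrightarrow> sph_dist x y \<ge> pi / 3)"

definition kissing_number :: "'a::real_inner itself \<Rightarrow> nat" where
  "kissing_number _ = Max {card S | S :: 'a set. kissing_config S}"

end

theory Submission
  imports Defs
begin

text \<open>
  Delsarte's method in the form extended by Musin.  Let \<open>f\<close> be a combination of Legendre
  polynomials with nonnegative coefficients and constant term 1.  Since every Legendre polynomial
  is a positive definite kernel on the sphere, a configuration \<open>S\<close> of \<open>n\<close> points satisfies
  \<open>n\<^sup>2 \<le> (\<Sum>x\<in>S. \<Sum>y\<in>S. f (x \<bullet> y))\<close>.  The polynomial \<open>f\<close> is chosen negative on
  \<open>[-0.708, 1/2]\<close>, so for a fixed \<open>x\<close> only \<open>y = x\<close> and the points \<open>y\<close> in the cap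
  \<open>x \<bullet> y < -0.708\<close> contribute.  As \<open>0.708\<^sup>2 > 1/2\<close>, the projections of these points to the plane
  orthogonal to \<open>x\<close> have pairwise negative inner products, so there are at most three of them.
  Cauchy-Schwarz gives a quadratic constraint on their heights, under which the inner sum stays
  below 13.  Hence \<open>n\<^sup>2 < 13 n\<close>.
\<close>

section \<open>Legendre polynomials as positive definite kernels\<close>

text \<open>Bonnet's recursion, with the index shifted so that the leading factor is
  \<open>n + 2\<close>.\<close>

fun legendre :: "nat \<Rightarrow> real \<Rightarrow> real" where
  "legendre 0 t = 1"
| "legendre (Suc 0) t = t"
| "legendre (Suc (Suc n)) t =
    ((2 * real n + 3) * t * legendre (Suc n) t - (real n + 1) * legendre n t) / (real n + 2)"

lemma legendre_1: "legendre 1 t = t"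
  by simp

text \<open>Closed forms reduce the addition formulas and the certificates below to identities that
  \<open>algebra\<close> decides. Degrees 5 to 8 lead up to degree 9.\<close>

lemma legendre_2: "legendre 2 t = (3 * t^2 - 1) / 2"
proof -
  have "legendre 2 t = (3 * t * legendre 1 t - 1 * legendre 0 t) / 2"
    using legendre.simps(3)[of 0 t] by (simp add: eval_nat_numeral del: legendre.simps(3))
  then show ?thesis
    unfolding legendre_1 legendre.simps(1) by algebra
qed

lemma legendre_3: "legendre 3 t = (5 * t^3 - 3 * t) / 2"
proof -
  have "legendre 3 t = (5 * t * legendre 2 t - 2 * legendre 1 t) / 3"
    using legendre.simps(3)[of 1 t] by (simp add: eval_nat_numeral del: legendre.simps(3))
  then show ?thesis
    unfolding legendre_2 legendre_1 by algebra
qed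

lemma legendre_4: "legendre 4 t = (35 * t^4 - 30 * t^2 + 3) / 8"
proof -
  have "legendre 4 t = (7 * t * legendre 3 t - 3 * legendre 2 t) / 4"
    using legendre.simps(3)[of 2 t] by (simp add: eval_nat_numeral del: legendre.simps(3))
  then show ?thesis
    unfolding legendre_3 legendre_2 by algebra
qed

lemma legendre_5: "legendre 5 t = (63 * t^5 - 70 * t^3 + 15 * t) / 8"
proof -
  have "legendre 5 t = (9 * t * legendre 4 t - 4 * legendre 3 t) / 5"
    using legendre.simps(3)[of 3 t] by (simp add: eval_nat_numeral del: legendre.simps(3))
  then show ?thesis
    unfolding legendre_4 legendre_3 by algebra
qed

lemma legendre_6: "legendre 6 t = (231 * t^6 - 315 * t^4 + 105 * t^2 - 5) / 16"
proof -
  have "legendre 6 t = (11 * t * legendre 5 t - 5 * legendre 4 t) / 6"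
    using legendre.simps(3)[of 4 t] by (simp add: eval_nat_numeral del: legendre.simps(3))
  then show ?thesis
    unfolding legendre_5 legendre_4 by algebra
qed

lemma legendre_7: "legendre 7 t = (429 * t^7 - 693 * t^5 + 315 * t^3 - 35 * t) / 16"
proof -
  have "legendre 7 t = (13 * t * legendre 6 t - 6 * legendre 5 t) / 7"
    using legendre.simps(3)[of 5 t] by (simp add: eval_nat_numeral del: legendre.simps(3))
  then show ?thesis
    unfolding legendre_6 legendre_5 by algebra
qed

lemma legendre_8: "legendre 8 t = (6435 * t^8 - 12012 * t^6 + 6930 * t^4 - 1260 * t^2 + 35) / 128"
proof -
  have "legendre 8 t = (15 * t * legendre 7 t - 7 * legendre 6 t) / 8"
    using legendre.simps(3)[of 6 t] by (simp add: eval_nat_numeral del: legendre.simps(3))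
  then show ?thesis
    unfolding legendre_7 legendre_6 by algebra
qed

lemma legendre_9: "legendre 9 t = (12155 * t^9 - 25740 * t^7 + 18018 * t^5 - 4620 * t^3 + 315 * t) / 128"
proof -
  have "legendre 9 t = (17 * t * legendre 8 t - 8 * legendre 7 t) / 9"
    using legendre.simps(3)[of 7 t] by (simp add: eval_nat_numeral del: legendre.simps(3))
  then show ?thesis
    unfolding legendre_8 legendre_7 by algebra
qed

section \<open>Real parts of powers of a complex number\<close>

text \<open>\<open>p\<close> is a root of X^2 - 2 (Re p) X + |p|^2, since p + cnj p = 2 Re p and p *
  cnj p = |p|^2. The exponents enter through equations so that the rule also matches
  numerals.\<close>

lemma Re_power_step:
  fixes p :: complex
  assumes "k = n + 1" "m = n + 2"
  shows "Re (p ^ m) = 2 * Re p * Re (p ^ k) - (cmod p)\<^sup>2 * Re (p ^ n)"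
proof -
  have "p ^ (n + 2) = of_real (2 * Re p) * p ^ (n + 1) - of_real ((cmod p)\<^sup>2) * p ^ n"
    unfolding complex_norm_square complex_add_cnj[symmetric] by (simp add: algebra_simps power2_eq_square)
  then have "Re (p ^ (n + 2)) = Re (of_real (2 * Re p) * p ^ (n + 1) - of_real ((cmod p)\<^sup>2) * p ^ n)"
    by (rule arg_cong)
  then show ?thesis
    unfolding assms by (simp only: minus_complex.sel times_complex.sel Re_complex_of_real Im_complex_of_real mult_zero_left diff_zero)
qed

text \<open>Homogenized Chebyshev polynomials: for |p| = 1 they give cos (m u) in terms of cos u.
  They make each addition formula a polynomial identity in \<open>z\<close>, \<open>w\<close> and
  \<open>Re p\<close>.\<close>

lemma Re_power_numerals:
  fixes p :: complex
  defines "a \<equiv> Re p" and "b \<equiv> (cmod p)\<^sup>2"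
  shows
    "Re (p ^ 2) = 2 * a^2 - b"
    "Re (p ^ 3) = 4 * a^3 - 3 * a * b"
    "Re (p ^ 4) = 8 * a^4 - 8 * a^2 * b + b^2"
    "Re (p ^ 5) = 16 * a^5 - 20 * a^3 * b + 5 * a * b^2"
    "Re (p ^ 6) = 32 * a^6 - 48 * a^4 * b + 18 * a^2 * b^2 - b^3"
    "Re (p ^ 7) = 64 * a^7 - 112 * a^5 * b + 56 * a^3 * b^2 - 7 * a * b^3"
    "Re (p ^ 8) = 128 * a^8 - 256 * a^6 * b + 160 * a^4 * b^2 - 32 * a^2 * b^3 + b^4"
    "Re (p ^ 9) = 256 * a^9 - 576 * a^7 * b + 432 * a^5 * b^2 - 120 * a^3 * b^3 + 9 * a * b^4"
proof -
  show 2: "Re (p ^ 2) = 2 * a^2 - b"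
    using Re_power_step[of 1 0 2 p] by (simp add: a_def b_def power2_eq_square)
  have "Re (p ^ 3) = 2 * a * Re (p ^ 2) - b * Re p"
    unfolding a_def b_def using Re_power_step[of 2 1 3 p] by simp
  then show 3: "Re (p ^ 3) = 4 * a^3 - 3 * a * b"
    unfolding 2 a_def[symmetric] by algebra
  have "Re (p ^ 4) = 2 * a * Re (p ^ 3) - b * Re (p ^ 2)"
    unfolding a_def b_def by (rule Re_power_step) simp_all
  then show 4: "Re (p ^ 4) = 8 * a^4 - 8 * a^2 * b + b^2"
    unfolding 3 2 by algebra
  have "Re (p ^ 5) = 2 * a * Re (p ^ 4) - b * Re (p ^ 3)"
    unfolding a_def b_def by (rule Re_power_step) simp_all
  then show 5: "Re (p ^ 5) = 16 * a^5 - 20 * a^3 * b + 5 * a * b^2"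
    unfolding 4 3 by algebra
  have "Re (p ^ 6) = 2 * a * Re (p ^ 5) - b * Re (p ^ 4)"
    unfolding a_def b_def by (rule Re_power_step) simp_all
  then show 6: "Re (p ^ 6) = 32 * a^6 - 48 * a^4 * b + 18 * a^2 * b^2 - b^3"
    unfolding 5 4 by algebra
  have "Re (p ^ 7) = 2 * a * Re (p ^ 6) - b * Re (p ^ 5)"
    unfolding a_def b_def by (rule Re_power_step) simp_all
  then show 7: "Re (p ^ 7) = 64 * a^7 - 112 * a^5 * b + 56 * a^3 * b^2 - 7 * a * b^3"
    unfolding 6 5 by algebra
  have "Re (p ^ 8) = 2 * a * Re (p ^ 7) - b * Re (p ^ 6)"
    unfolding a_def b_def by (rule Re_power_step) simp_all
  then show 8: "Re (p ^ 8) = 128 * a^8 - 256 * a^6 * b + 160 * a^4 * b^2 - 32 * a^2 * b^3 + b^4"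
    unfolding 7 6 by algebra
  have "Re (p ^ 9) = 2 * a * Re (p ^ 8) - b * Re (p ^ 7)"
    unfolding a_def b_def by (rule Re_power_step) simp_all
  then show 9: "Re (p ^ 9) = 256 * a^9 - 576 * a^7 * b + 432 * a^5 * b^2 - 120 * a^3 * b^3 + 9 * a * b^4"
    unfolding 8 7 by algebra
qed

section \<open>Addition formulas and positive definiteness\<close>

text \<open>With complex values, the argument of \<open>horizontal x * cnj (horizontal y)\<close> is
  the difference of the longitudes.\<close>

definition horizontal :: "real^3 \<Rightarrow> complex" where
  "horizontal x = Complex (x $ 1) (x $ 2)"

lemma inner_eq_horizontal:
  "x \<bullet> y = x $ 3 * y $ 3 + Re (horizontal x * cnj (horizontal y))"
  by (simp add: horizontal_def inner_vec_def sum_3)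

lemma cmod_horizontal:
  assumes "norm x = 1"
  shows "(cmod (horizontal x))\<^sup>2 = 1 - (x $ 3)\<^sup>2"
proof -
  have "x \<bullet> x = 1"
    using assms by (simp add: dot_square_norm)
  then show ?thesis
    unfolding cmod_power2 by (simp add: horizontal_def inner_vec_def sum_3 power2_eq_square)
qed

text \<open>The kernel factors, so the double sum is the squared modulus of the single sum of
  \<open>A x * h x ^ m\<close>.\<close>

lemma sum_hermitian_kernel_nonneg:
  fixes h :: "'a \<Rightarrow> complex" and A :: "'a \<Rightarrow> real"
  shows "0 \<le> (\<Sum>x\<in>S. \<Sum>y\<in>S. A x * A y * Re ((h x * cnj (h y)) ^ m))"
proof -
  define g where "g x = of_real (A x) * h x ^ m" for x
  have "(\<Sum>x\<in>S. \<Sum>y\<in>S. A x * A y * Re ((h x * cnj (h y)) ^ m)) = (\<Sum>x\<in>S. \<Sum>y\<in>S. Re (g x * cnj (g y)))"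
  proof (intro sum.cong refl)
    fix x y
    have "g x * cnj (g y) = of_real (A x * A y) * (h x * cnj (h y)) ^ m"
      by (simp add: g_def power_mult_distrib)
    then show "A x * A y * Re ((h x * cnj (h y)) ^ m) = Re (g x * cnj (g y))"
      by (simp only: times_complex.sel Re_complex_of_real Im_complex_of_real mult_zero_left diff_zero)
  qed
  also have "\<dots> = Re (sum g S * cnj (sum g S))"
    by (simp add: sum_product)
  also have "\<dots> = (cmod (sum g S))\<^sup>2"
    by (simp add: complex_norm_square[symmetric] del: cnj_sum)
  finally show ?thesis
    by simp
qed

text \<open>Here \<open>z\<close> and \<open>w\<close> stand for the heights of two unit vectors and
  \<open>p\<close> for the product of one horizontal part with the conjugate of the other; the
  condition on \<open>cmod p\<close> is what unit length gives. Each order \<open>m\<close> then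
  contributes a hermitian kernel with nonnegative weight.\<close>

lemma addition_formula_imp_kernel_nonneg:
  fixes S :: "(real^3) set"
  assumes add: "\<And>z w p. (cmod p)\<^sup>2 = (1 - z\<^sup>2) * (1 - w\<^sup>2) \<Longrightarrow>
      K (z * w + Re p) = (\<Sum>m\<le>k. c m * A m z * A m w * Re (p ^ m))"
    and c: "\<And>m. m \<le> k \<Longrightarrow> 0 \<le> c m"
    and S: "S \<subseteq> sphere 0 1"
  shows "0 \<le> (\<Sum>x\<in>S. \<Sum>y\<in>S. K (x \<bullet> y))"
proof -
  let ?T = "\<lambda>m x y. A m (x $ 3) * A m (y $ 3) * Re ((horizontal x * cnj (horizontal y)) ^ m)"
  have K: "K (x \<bullet> y) = (\<Sum>m\<le>k. c m * ?T m x y)" if "x \<in> S" "y \<in> S" for x y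
  proof -
    have "norm x = 1" "norm y = 1"
      using S that by auto
    then have "(cmod (horizontal x * cnj (horizontal y)))\<^sup>2 = (1 - (x $ 3)\<^sup>2) * (1 - (y $ 3)\<^sup>2)"
      by (simp add: norm_mult power_mult_distrib cmod_horizontal)
    from add[OF this] show ?thesis
      unfolding inner_eq_horizontal by (simp add: mult.assoc)
  qed
  have "(\<Sum>x\<in>S. \<Sum>y\<in>S. K (x \<bullet> y)) = (\<Sum>x\<in>S. \<Sum>y\<in>S. \<Sum>m\<le>k. c m * ?T m x y)"
    using K by simp
  also have "\<dots> = (\<Sum>x\<in>S. \<Sum>m\<le>k. \<Sum>y\<in>S. c m * ?T m x y)"
    by (intro sum.cong refl sum.swap)
  also have "\<dots> = (\<Sum>m\<le>k. \<Sum>x\<in>S. \<Sum>y\<in>S. c m * ?T m x y)"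
    by (rule sum.swap)
  also have "\<dots> = (\<Sum>m\<le>k. c m * (\<Sum>x\<in>S. \<Sum>y\<in>S. ?T m x y))"
    by (simp add: sum_distrib_left)
  also have "\<dots> \<ge> 0"
    using c by (intro sum_nonneg mult_nonneg_nonneg sum_hermitian_kernel_nonneg) auto
  finally show ?thesis .
qed

text \<open>
  The coefficient functions in the addition formulas are rescaled derivatives of the Legendre polynomials,
  that is, associated Legendre functions without the power of \<open>1 - z\<^sup>2\<close>.
\<close>

lemma legendre_1_kernel_nonneg:
  fixes S :: "(real^3) set"
  assumes "S \<subseteq> sphere 0 1"
  shows "0 \<le> (\<Sum>x\<in>S. \<Sum>y\<in>S. legendre 1 (x \<bullet> y))"
proof (rule addition_formula_imp_kernel_nonneg[OF _ _ assms])
  let ?c = "\<lambda>m. [1, 1] ! m :: real"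
  let ?A = "\<lambda>m z. [z, 1] ! m :: real"
  show "legendre 1 (z * w + Re p) = (\<Sum>m\<le>1. ?c m * ?A m z * ?A m w * Re (p ^ m))"
    if p: "(cmod p)\<^sup>2 = (1 - z\<^sup>2) * (1 - w\<^sup>2)" for z w p
  proof -
    have "(\<Sum>m\<le>1. ?c m * ?A m z * ?A m w * Re (p ^ m)) =
      1 * z * w +
      1 * Re p"
      by (simp)
    then show ?thesis
      unfolding legendre_1 by algebra
  qed
  show "0 \<le> ?c m" if "m \<le> 1" for m
  proof -
    have "m \<in> {..1}"
      using that by simp
    then show ?thesis
      by (auto simp: atMost_nat_numeral le_Suc_eq)
  qed
qed

lemma legendre_2_kernel_nonneg:
  fixes S :: "(real^3) set"
  assumes "S \<subseteq> sphere 0 1"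
  shows "0 \<le> (\<Sum>x\<in>S. \<Sum>y\<in>S. legendre 2 (x \<bullet> y))"
proof (rule addition_formula_imp_kernel_nonneg[OF _ _ assms])
  let ?c = "\<lambda>m. [1 / 4, 3, 3 / 4] ! m :: real"
  let ?A = "\<lambda>m z. [3 * z^2 - 1, z, 1] ! m :: real"
  show "legendre 2 (z * w + Re p) = (\<Sum>m\<le>2. ?c m * ?A m z * ?A m w * Re (p ^ m))"
    if p: "(cmod p)\<^sup>2 = (1 - z\<^sup>2) * (1 - w\<^sup>2)" for z w p
  proof -
    have "(\<Sum>m\<le>2. ?c m * ?A m z * ?A m w * Re (p ^ m)) =
      1 / 4 * (3 * z^2 - 1) * (3 * w^2 - 1) +
      3 * z * w * Re p +
      3 / 4 * Re (p ^ 2)"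
      by (simp add: atMost_nat_numeral)
    then show ?thesis
      unfolding legendre_2 Re_power_numerals p by algebra
  qed
  show "0 \<le> ?c m" if "m \<le> 2" for m
  proof -
    have "m \<in> {..2}"
      using that by simp
    then show ?thesis
      by (auto simp: atMost_nat_numeral le_Suc_eq)
  qed
qed

lemma legendre_3_kernel_nonneg:
  fixes S :: "(real^3) set"
  assumes "S \<subseteq> sphere 0 1"
  shows "0 \<le> (\<Sum>x\<in>S. \<Sum>y\<in>S. legendre 3 (x \<bullet> y))"
proof (rule addition_formula_imp_kernel_nonneg[OF _ _ assms])
  let ?c = "\<lambda>m. [1 / 4, 3 / 8, 15 / 4, 5 / 8] ! m :: real"
  let ?A = "\<lambda>m z. [5 * z^3 - 3 * z, 5 * z^2 - 1, z, 1] ! m :: real"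
  show "legendre 3 (z * w + Re p) = (\<Sum>m\<le>3. ?c m * ?A m z * ?A m w * Re (p ^ m))"
    if p: "(cmod p)\<^sup>2 = (1 - z\<^sup>2) * (1 - w\<^sup>2)" for z w p
  proof -
    have "(\<Sum>m\<le>3. ?c m * ?A m z * ?A m w * Re (p ^ m)) =
      1 / 4 * (5 * z^3 - 3 * z) * (5 * w^3 - 3 * w) +
      3 / 8 * (5 * z^2 - 1) * (5 * w^2 - 1) * Re p +
      15 / 4 * z * w * Re (p ^ 2) +
      5 / 8 * Re (p ^ 3)"
      by (simp add: atMost_nat_numeral)
    then show ?thesis
      unfolding legendre_3 Re_power_numerals p by algebra
  qed
  show "0 \<le> ?c m" if "m \<le> 3" for m
  proof -
    have "m \<in> {..3}"
      using that by simp
    then show ?thesis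
      by (auto simp: atMost_nat_numeral le_Suc_eq)
  qed
qed

lemma legendre_4_kernel_nonneg:
  fixes S :: "(real^3) set"
  assumes "S \<subseteq> sphere 0 1"
  shows "0 \<le> (\<Sum>x\<in>S. \<Sum>y\<in>S. legendre 4 (x \<bullet> y))"
proof (rule addition_formula_imp_kernel_nonneg[OF _ _ assms])
  let ?c = "\<lambda>m. [1 / 64, 5 / 8, 5 / 16, 35 / 8, 35 / 64] ! m :: real"
  let ?A = "\<lambda>m z. [35 * z^4 - 30 * z^2 + 3, 7 * z^3 - 3 * z, 7 * z^2 - 1, z, 1] ! m :: real"
  show "legendre 4 (z * w + Re p) = (\<Sum>m\<le>4. ?c m * ?A m z * ?A m w * Re (p ^ m))"
    if p: "(cmod p)\<^sup>2 = (1 - z\<^sup>2) * (1 - w\<^sup>2)" for z w p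
  proof -
    have "(\<Sum>m\<le>4. ?c m * ?A m z * ?A m w * Re (p ^ m)) =
      1 / 64 * (35 * z^4 - 30 * z^2 + 3) * (35 * w^4 - 30 * w^2 + 3) +
      5 / 8 * (7 * z^3 - 3 * z) * (7 * w^3 - 3 * w) * Re p +
      5 / 16 * (7 * z^2 - 1) * (7 * w^2 - 1) * Re (p ^ 2) +
      35 / 8 * z * w * Re (p ^ 3) +
      35 / 64 * Re (p ^ 4)"
      by (simp add: atMost_nat_numeral)
    then show ?thesis
      unfolding legendre_4 Re_power_numerals p by algebra
  qed
  show "0 \<le> ?c m" if "m \<le> 4" for m
  proof -
    have "m \<in> {..4}"
      using that by simp
    then show ?thesis
      by (auto simp: atMost_nat_numeral le_Suc_eq)
  qed
qed

text \<open>Degrees 5 to 8 do not occur in \<open>delsarte_poly\<close>, so degree 9 comes right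
  after degree 4.\<close>

lemma legendre_9_kernel_nonneg:
  fixes S :: "(real^3) set"
  assumes "S \<subseteq> sphere 0 1"
  shows "0 \<le> (\<Sum>x\<in>S. \<Sum>y\<in>S. legendre 9 (x \<bullet> y))"
proof (rule addition_formula_imp_kernel_nonneg[OF _ _ assms])
  let ?c = "\<lambda>m. [1 / 16384, 45 / 16384, 495 / 2048, 1155 / 8192, 45045 / 4096, 1287 / 8192, 2145 / 2048, 6435 / 32768, 109395 / 16384, 12155 / 32768] ! m :: real"
  let ?A = "\<lambda>m z. [12155 * z^9 - 25740 * z^7 + 18018 * z^5 - 4620 * z^3 + 315 * z, 2431 * z^8 - 4004 * z^6 + 2002 * z^4 - 308 * z^2 + 7, 221 * z^7 - 273 * z^5 + 91 * z^3 - 7 * z, 221 * z^6 - 195 * z^4 + 39 * z^2 - 1, 17 * z^5 - 10 * z^3 + z, 85 * z^4 - 30 * z^2 + 1, 17 * z^3 - 3 * z, 17 * z^2 - 1, z, 1] ! m :: real"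
  show "legendre 9 (z * w + Re p) = (\<Sum>m\<le>9. ?c m * ?A m z * ?A m w * Re (p ^ m))"
    if p: "(cmod p)\<^sup>2 = (1 - z\<^sup>2) * (1 - w\<^sup>2)" for z w p
  proof -
    have "(\<Sum>m\<le>9. ?c m * ?A m z * ?A m w * Re (p ^ m)) =
      1 / 16384 * (12155 * z^9 - 25740 * z^7 + 18018 * z^5 - 4620 * z^3 + 315 * z) * (12155 * w^9 - 25740 * w^7 + 18018 * w^5 - 4620 * w^3 + 315 * w) +
      45 / 16384 * (2431 * z^8 - 4004 * z^6 + 2002 * z^4 - 308 * z^2 + 7) * (2431 * w^8 - 4004 * w^6 + 2002 * w^4 - 308 * w^2 + 7) * Re p +
      495 / 2048 * (221 * z^7 - 273 * z^5 + 91 * z^3 - 7 * z) * (221 * w^7 - 273 * w^5 + 91 * w^3 - 7 * w) * Re (p ^ 2) +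
      1155 / 8192 * (221 * z^6 - 195 * z^4 + 39 * z^2 - 1) * (221 * w^6 - 195 * w^4 + 39 * w^2 - 1) * Re (p ^ 3) +
      45045 / 4096 * (17 * z^5 - 10 * z^3 + z) * (17 * w^5 - 10 * w^3 + w) * Re (p ^ 4) +
      1287 / 8192 * (85 * z^4 - 30 * z^2 + 1) * (85 * w^4 - 30 * w^2 + 1) * Re (p ^ 5) +
      2145 / 2048 * (17 * z^3 - 3 * z) * (17 * w^3 - 3 * w) * Re (p ^ 6) +
      6435 / 32768 * (17 * z^2 - 1) * (17 * w^2 - 1) * Re (p ^ 7) +
      109395 / 16384 * z * w * Re (p ^ 8) +
      12155 / 32768 * Re (p ^ 9)"
      by (simp add: atMost_nat_numeral)
    then show ?thesis
      unfolding legendre_9 Re_power_numerals p by algebra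
  qed
  show "0 \<le> ?c m" if "m \<le> 9" for m
  proof -
    have "m \<in> {..9}"
      using that by simp
    then show ?thesis
      by (auto simp: atMost_nat_numeral le_Suc_eq)
  qed
qed

section \<open>The auxiliary polynomial\<close>

text \<open>
  The coefficients are a rounded solution of a linear program which minimizes the bound on the
  sums \<open>\<Sum>y\<in>S. f (x \<bullet> y)\<close>.
\<close>

definition delsarte_poly :: "real \<Rightarrow> real" where
  "delsarte_poly t = 1 + 1775 / 1000 * legendre 1 t + 3504 / 1000 * legendre 2 t
     + 1738 / 1000 * legendre 3 t + 1992 / 1000 * legendre 4 t + 426 / 1000 * legendre 9 t"

lemma delsarte_poly_1: "delsarte_poly 1 = 10435 / 1000"
  by (simp add: delsarte_poly_def legendre_1 legendre_2 legendre_3 legendre_4 legendre_9)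

lemma delsarte_poly_kernel:
  fixes S :: "(real^3) set"
  assumes "finite S" "S \<subseteq> sphere 0 1"
  shows "(real (card S))\<^sup>2 \<le> (\<Sum>x\<in>S. \<Sum>y\<in>S. delsarte_poly (x \<bullet> y))"
proof -
  have "(\<Sum>x\<in>S. \<Sum>y\<in>S. delsarte_poly (x \<bullet> y)) = (real (card S))\<^sup>2
      + 1775 / 1000 * (\<Sum>x\<in>S. \<Sum>y\<in>S. legendre 1 (x \<bullet> y))
      + 3504 / 1000 * (\<Sum>x\<in>S. \<Sum>y\<in>S. legendre 2 (x \<bullet> y))
      + 1738 / 1000 * (\<Sum>x\<in>S. \<Sum>y\<in>S. legendre 3 (x \<bullet> y))
      + 1992 / 1000 * (\<Sum>x\<in>S. \<Sum>y\<in>S. legendre 4 (x \<bullet> y))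
      + 426 / 1000 * (\<Sum>x\<in>S. \<Sum>y\<in>S. legendre 9 (x \<bullet> y))"
    unfolding delsarte_poly_def sum.distrib sum_distrib_left[symmetric]
    by (simp only: sum_constant power2_eq_square mult_1_right)
  then show ?thesis
    using assms(2) legendre_1_kernel_nonneg[of S] legendre_2_kernel_nonneg[of S] legendre_3_kernel_nonneg[of S]
      legendre_4_kernel_nonneg[of S] legendre_9_kernel_nonneg[of S]
    by linarith
qed

section \<open>Polynomial bounds by sums of squares\<close>

text \<open>Serves the remainders of the certificates: with every power confined to [-1, 1],
  positivity of \<open>r\<close> is a linear problem in the powers.\<close>

lemma abs_power_bounds:
  fixes t :: real
  assumes "\<bar>t\<bar> \<le> 1"
  shows "- 1 \<le> t ^ k" "t ^ k \<le> 1"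
  using power_le_one[of "\<bar>t\<bar>" k] assms by (auto simp: abs_le_iff simp flip: power_abs)

text \<open>
  Sum-of-squares certificates \<open>p = (t - a) * \<sigma> + (b - t) * \<tau> + r\<close> for \<open>p \<ge> 0\<close> on \<open>[a, b]\<close>
  come from semidefinite programming.  Rounding the squares leaves the remainder \<open>r\<close>, whose
  constant term exceeds the sum of the absolute values of its other coefficients.
\<close>

lemma delsarte_poly_nonpos:
  assumes "- 708 / 1000 \<le> t" "t \<le> 1 / 2"
  shows "delsarte_poly t \<le> 0"
proof -
  \<comment> \<open>The squares have the triangular shape of a Cholesky factorization of a Gram
    matrix. Their coefficients are scaled by 10^6 to be integers, which the division by 10^12 in
    \<open>eq\<close> undoes.\<close>
  define \<sigma> \<tau> r where
    "\<sigma> =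
      (9434544 * t^4 + 5638202 * t^3 - 2807734 * t^2 - 1298621 * t + 60390)^2 +
      (- 1718899 * t^4 - 1900217 * t^3 + 507369 * t^2 + 441509 * t)^2 +
      (- 9373297 * t^4 + 806398 * t^3 + 1943853 * t^2)^2 +
      (- 233155 * t^4 + 205874 * t^3)^2 +
      (327733 * t^4)^2"
    and "\<tau> =
      (11672168 * t^4 + 6899355 * t^3 - 3273854 * t^2 - 1543082 * t + 67645)^2 +
      (- 4712282 * t^4 - 3770570 * t^3 + 329643 * t^2 + 449661 * t)^2 +
      (7852361 * t^4 + 8805498 * t^3 + 2300446 * t^2)^2 +
      (576816 * t^4 + 408914 * t^3)^2 +
      (40593 * t^4)^2"
    and "r =
      1300349007 / 10000000000000 - 17714099 / 25000000000000 * t - 660355879 / 250000000000000 *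
      t^2 + 23295517 / 12500000000000 * t^3 + 3300444463 / 250000000000000 * t^4 + 761936249 /
      125000000000000 * t^5 - 1723650487 / 125000000000000 * t^6 - 74269993 / 25000000000000 * t^7
      + 3758893 / 25000000000000 * t^8 - 7613543 / 500000000000 * t^9"
  have nonneg: "0 \<le> (t + 708 / 1000) * \<sigma> + (1 / 2 - t) * \<tau>"
    using assms unfolding \<sigma>_def \<tau>_def
    by (intro add_nonneg_nonneg[OF mult_nonneg_nonneg mult_nonneg_nonneg]
      add_nonneg_nonneg[OF _ zero_le_power2] zero_le_power2) auto
  have eq: "- delsarte_poly t = ((t + 708 / 1000) * \<sigma> + (1 / 2 - t) * \<tau>) / 1000000000000 + r"
    unfolding delsarte_poly_def legendre_1 legendre_2 legendre_3 legendre_4 legendre_9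
      \<sigma>_def \<tau>_def r_def
    by algebra
  have "\<bar>t\<bar> \<le> 1"
    using assms by (auto simp: abs_le_iff)
  then have "0 \<le> r"
    using abs_power_bounds[of t 1] abs_power_bounds[of t 2] abs_power_bounds[of t 3]
      abs_power_bounds[of t 4] abs_power_bounds[of t 5] abs_power_bounds[of t 6]
      abs_power_bounds[of t 7] abs_power_bounds[of t 8] abs_power_bounds[of t 9]
    unfolding power_one_right r_def by linarith
  then have "0 \<le> - delsarte_poly t"
    unfolding eq using nonneg by (intro add_nonneg_nonneg[OF divide_nonneg_nonneg]) simp_all
  then show ?thesis
    by simp
qed

text \<open>For caps with a single point. The two sharper majorants below exceed this constant at
  \<open>s = 1\<close>.\<close>

lemma delsarte_poly_cap_le_const:
  assumes "708 / 1000 \<le> s" "s \<le> 1"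
  shows "delsarte_poly (- s) \<le> 2564 / 1000"
proof -
  \<comment> \<open>This maps [708/1000, 1] onto [-71/75, 1], so the powers of \<open>y\<close> lie
    in [-1, 1] and the weights \<open>y + 71 / 75\<close> and \<open>1 - y\<close> are
    nonnegative.\<close>
  define y where "y = (20 * s - 17) / 3"
  have s: "s = 17 / 20 + 3 / 20 * y"
    by (simp add: y_def field_simps)
  define \<sigma> \<tau> r where
    "\<sigma> =
      (- 79524 * y^4 + 253290 * y^3 - 145198 * y^2 - 113886 * y + 85988)^2 +
      (369353 * y^4 - 381865 * y^3 - 222106 * y^2 + 236582 * y)^2 +
      (105084 * y^4 - 261948 * y^3 + 155569 * y^2)^2 +
      (- 158433 * y^4 + 154938 * y^3)^2 +
      (2736 * y^4)^2"
    and "\<tau> =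
      (247880 * y^4 - 16050 * y^3 - 321238 * y^2 + 10324 * y + 91725)^2 +
      (117629 * y^4 - 230797 * y^3 - 82852 * y^2 + 180700 * y)^2 +
      (- 315290 * y^4 + 13843 * y^3 + 263753 * y^2)^2 +
      (- 60603 * y^4 + 60099 * y^3)^2 +
      (23140 * y^4)^2"
    and "r =
      196953248057237 / 98304000000000000 - 552379666451 / 32768000000000000 * y + 11529691623 /
      8192000000000000 * y^2 + 1239409686499 / 24576000000000000 * y^3 - 937922305477 /
      49152000000000000 * y^4 - 2938059009311 / 49152000000000000 * y^5 + 251698728747 /
      8192000000000000 * y^6 + 471213900511 / 24576000000000000 * y^7 - 2938353747427 /
      98304000000000000 * y^8 + 134660509089 / 6553600000000000 * y^9"
  have nonneg: "0 \<le> (y + 71 / 75) * \<sigma> + (1 - y) * \<tau>"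
    using assms unfolding \<sigma>_def \<tau>_def
    by (intro add_nonneg_nonneg[OF mult_nonneg_nonneg mult_nonneg_nonneg]
      add_nonneg_nonneg[OF _ zero_le_power2] zero_le_power2) (auto simp: y_def field_simps)
  have eq: "2564 / 1000 - delsarte_poly (- s) = ((y + 71 / 75) * \<sigma> + (1 - y) * \<tau>) / 10000000000 + r"
    unfolding delsarte_poly_def legendre_1 legendre_2 legendre_3 legendre_4 legendre_9
      \<sigma>_def \<tau>_def r_def s
    by algebra
  have "\<bar>y\<bar> \<le> 1"
    using assms by (auto simp: y_def abs_le_iff field_simps)
  then have "0 \<le> r"
    using abs_power_bounds[of y 1] abs_power_bounds[of y 2] abs_power_bounds[of y 3]
      abs_power_bounds[of y 4] abs_power_bounds[of y 5] abs_power_bounds[of y 6]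
      abs_power_bounds[of y 7] abs_power_bounds[of y 8] abs_power_bounds[of y 9]
    unfolding power_one_right r_def by linarith
  then have "0 \<le> 2564 / 1000 - delsarte_poly (- s)"
    unfolding eq using nonneg by (intro add_nonneg_nonneg[OF divide_nonneg_nonneg]) simp_all
  then show ?thesis
    by simp
qed

text \<open>For caps with two points. The coefficients are tuned so that the pair bound becomes
  almost constant along the boundary of the height constraint.\<close>

lemma delsarte_poly_cap_le_cubic:
  assumes "708 / 1000 \<le> s" "s \<le> 1"
  shows "delsarte_poly (- s) \<le> 1109 / 1000 + 1028 / 100 * (s - 17 / 20) + 185 / 10 * (s - 17 / 20)^2 + 73 / 10 * (s - 17 / 20)^3"
proof -
  define y where "y = (20 * s - 17) / 3"
  have s: "s = 17 / 20 + 3 / 20 * y"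
    by (simp add: y_def field_simps)
  define \<sigma> \<tau> r where
    "\<sigma> =
      (37222 * y^4 + 48335 * y^3 - 60322 * y^2 - 30907 * y + 20252)^2 +
      (146827 * y^4 - 76322 * y^3 - 109520 * y^2 + 52175 * y)^2 +
      (- 34791 * y^4 - 29039 * y^3 + 23772 * y^2)^2 +
      (- 39134 * y^4 + 25485 * y^3)^2 +
      (23831 * y^4)^2"
    and "\<tau> =
      (106262 * y^4 + 43207 * y^3 - 101901 * y^2 - 22233 * y + 22109)^2 +
      (- 53489 * y^4 - 106675 * y^3 - 15237 * y^2 + 35332 * y)^2 +
      (- 108614 * y^4 - 51379 * y^3 + 47236 * y^2)^2 +
      (17285 * y^4 + 16265 * y^3)^2 +
      (2218 * y^4)^2"
    and "r =
      59243531290517 / 98304000000000000 - 58377531449 / 98304000000000000 * y - 310329154123 /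
      24576000000000000 * y^2 - 217133844509 / 24576000000000000 * y^3 + 212643728233 /
      16384000000000000 * y^4 + 360462141003 / 16384000000000000 * y^5 + 86503280427 /
      8192000000000000 * y^6 - 10140188623 / 1638400000000000 * y^7 - 1246716888547 /
      98304000000000000 * y^8 - 34307682911 / 6553600000000000 * y^9"
  have nonneg: "0 \<le> (y + 71 / 75) * \<sigma> + (1 - y) * \<tau>"
    using assms unfolding \<sigma>_def \<tau>_def
    by (intro add_nonneg_nonneg[OF mult_nonneg_nonneg mult_nonneg_nonneg]
      add_nonneg_nonneg[OF _ zero_le_power2] zero_le_power2) (auto simp: y_def field_simps)
  have eq: "1109 / 1000 + 1028 / 100 * (s - 17 / 20) + 185 / 10 * (s - 17 / 20)^2 + 73 / 10 * (s - 17 / 20)^3 - delsarte_poly (- s) = ((y + 71 / 75) * \<sigma> + (1 - y) * \<tau>) / 10000000000 + r"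
    unfolding delsarte_poly_def legendre_1 legendre_2 legendre_3 legendre_4 legendre_9
      \<sigma>_def \<tau>_def r_def s
    by algebra
  have "\<bar>y\<bar> \<le> 1"
    using assms by (auto simp: y_def abs_le_iff field_simps)
  then have "0 \<le> r"
    using abs_power_bounds[of y 1] abs_power_bounds[of y 2] abs_power_bounds[of y 3]
      abs_power_bounds[of y 4] abs_power_bounds[of y 5] abs_power_bounds[of y 6]
      abs_power_bounds[of y 7] abs_power_bounds[of y 8] abs_power_bounds[of y 9]
    unfolding power_one_right r_def by linarith
  then have "0 \<le> 1109 / 1000 + 1028 / 100 * (s - 17 / 20) + 185 / 10 * (s - 17 / 20)^2 + 73 / 10 * (s - 17 / 20)^3 - delsarte_poly (- s)"
    unfolding eq using nonneg by (intro add_nonneg_nonneg[OF divide_nonneg_nonneg]) simp_all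
  then show ?thesis
    by simp
qed

text \<open>For caps with three points. The sum of a quadratic majorant depends only on the sum of
  the heights and the sum of their squares, the two quantities in the height constraint.\<close>

lemma delsarte_poly_cap_le_quadratic:
  assumes "708 / 1000 \<le> s" "s \<le> 1"
  shows "delsarte_poly (- s) \<le> 1173 / 1000 + 997 / 100 * (s - 17 / 20) + 1212 / 100 * (s - 17 / 20)^2"
proof -
  define y where "y = (20 * s - 17) / 3"
  have s: "s = 17 / 20 + 3 / 20 * y"
    by (simp add: y_def field_simps)
  define \<sigma> \<tau> r where
    "\<sigma> =
      (36759 * y^4 + 49049 * y^3 - 70645 * y^2 - 30457 * y + 26635)^2 +
      (160072 * y^4 - 101915 * y^3 - 117455 * y^2 + 69787 * y)^2 +
      (- 33874 * y^4 - 30870 * y^3 + 30413 * y^2)^2 +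
      (- 47473 * y^4 + 29233 * y^3)^2 +
      (14851 * y^4)^2"
    and "\<tau> =
      (120838 * y^4 + 38083 * y^3 - 122722 * y^2 - 17881 * y + 29077)^2 +
      (- 48374 * y^4 - 105943 * y^3 - 6740 * y^2 + 46631 * y)^2 +
      (- 116519 * y^4 - 44088 * y^3 + 60959 * y^2)^2 +
      (8564 * y^4 + 7359 * y^3)^2 +
      (2041 * y^4)^2"
    and "r =
      11883734175313 / 19660800000000000 - 90682378661 / 19660800000000000 * y - 94039694873 /
      8192000000000000 * y^2 + 110589666503 / 4915200000000000 * y^3 - 332457221573 /
      49152000000000000 * y^4 - 796703209909 / 16384000000000000 * y^5 + 462905961857 /
      24576000000000000 * y^6 + 201962193141 / 8192000000000000 * y^7 - 168310212067 /
      98304000000000000 * y^8 + 73229028769 / 6553600000000000 * y^9"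
  have nonneg: "0 \<le> (y + 71 / 75) * \<sigma> + (1 - y) * \<tau>"
    using assms unfolding \<sigma>_def \<tau>_def
    by (intro add_nonneg_nonneg[OF mult_nonneg_nonneg mult_nonneg_nonneg]
      add_nonneg_nonneg[OF _ zero_le_power2] zero_le_power2) (auto simp: y_def field_simps)
  have eq: "1173 / 1000 + 997 / 100 * (s - 17 / 20) + 1212 / 100 * (s - 17 / 20)^2 - delsarte_poly (- s) = ((y + 71 / 75) * \<sigma> + (1 - y) * \<tau>) / 10000000000 + r"
    unfolding delsarte_poly_def legendre_1 legendre_2 legendre_3 legendre_4 legendre_9
      \<sigma>_def \<tau>_def r_def s
    by algebra
  have "\<bar>y\<bar> \<le> 1"
    using assms by (auto simp: y_def abs_le_iff field_simps)
  then have "0 \<le> r"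
    using abs_power_bounds[of y 1] abs_power_bounds[of y 2] abs_power_bounds[of y 3]
      abs_power_bounds[of y 4] abs_power_bounds[of y 5] abs_power_bounds[of y 6]
      abs_power_bounds[of y 7] abs_power_bounds[of y 8] abs_power_bounds[of y 9]
    unfolding power_one_right r_def by linarith
  then have "0 \<le> 1173 / 1000 + 997 / 100 * (s - 17 / 20) + 1212 / 100 * (s - 17 / 20)^2 - delsarte_poly (- s)"
    unfolding eq using nonneg by (intro add_nonneg_nonneg[OF divide_nonneg_nonneg]) simp_all
  then show ?thesis
    by simp
qed

section \<open>Points in a spherical cap\<close>

text \<open>Set one vector aside. If there were too many, the others together with \<open>u\<close>
  would be dependent, and orthogonality removes \<open>u\<close> from the relation. Separating
  positive from nonpositive coefficients writes one vector \<open>w\<close> in two ways, so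
  \<open>w \<bullet> w\<close> is at most 0 and \<open>w = 0\<close>. But \<open>w\<close> has
  negative inner product with the vector set aside.\<close>

lemma card_pairwise_negative_orthogonal_le:
  fixes p :: "'b \<Rightarrow> 'a::euclidean_space"
  assumes "finite T" and u: "u \<noteq> 0"
    and orth: "\<And>i. i \<in> T \<Longrightarrow> u \<bullet> p i = 0"
    and neg: "\<And>i j. i \<in> T \<Longrightarrow> j \<in> T \<Longrightarrow> i \<noteq> j \<Longrightarrow> p i \<bullet> p j < 0"
  shows "card T \<le> DIM('a)"
proof (rule ccontr)
  assume card: "\<not> card T \<le> DIM('a)"
  then obtain k where k: "k \<in> T"
    by fastforce
  define B where "B = p ` (T - {k})"
  \<comment> \<open>A repeated vector would have a negative inner product with itself.\<close>
  have "inj_on p T"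
    by (intro inj_onI) (metis inner_ge_zero neg not_less)
  then have "card B = card T - 1"
    unfolding B_def using k \<open>finite T\<close> by (simp add: card_image inj_on_diff)
  have fin: "finite B"
    unfolding B_def using \<open>finite T\<close> by simp
  have uB: "u \<bullet> b = 0" if "b \<in> B" for b
    using that orth by (auto simp: B_def)
  then have "u \<notin> B"
    using u by (metis inner_eq_zero_iff)
  have negB: "a \<bullet> b < 0" if "a \<in> B" "b \<in> B" "a \<noteq> b" for a b
    using that neg by (auto simp: B_def)
  have negk: "b \<bullet> p k < 0" if "b \<in> B" for b
    using that neg k by (auto simp: B_def)
  have "dependent (insert u B)"
    using card k \<open>card B = card T - 1\<close> \<open>u \<notin> B\<close> fin by (intro dependent_biggerset) simp
  then obtain c v where c: "(\<Sum>b\<in>insert u B. c b *\<^sub>R b) = 0" and v: "v \<in> insert u B" "c v \<noteq> 0"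
    using fin by (auto simp: dependent_finite)
  have "c u * (u \<bullet> u) = u \<bullet> (\<Sum>b\<in>insert u B. c b *\<^sub>R b)"
    using fin \<open>u \<notin> B\<close> uB by (simp add: inner_sum_right inner_add_right)
  then have "c u = 0"
    using c u by simp
  then have sum0: "(\<Sum>b\<in>B. c b *\<^sub>R b) = 0" and "v \<in> B"
    using c v fin \<open>u \<notin> B\<close> by auto
  \<comment> \<open>Changing the sign of the relation if necessary makes its positive part
    nonempty.\<close>
  obtain d where d: "(\<Sum>b\<in>B. d b *\<^sub>R b) = 0" and dv: "d v > 0"
  proof (cases "c v > 0")
    case True
    then show ?thesis
      using that sum0 by blast
  next
    case False
    then have "- c v > 0"
      using v by simp
    moreover have "(\<Sum>b\<in>B. (- c b) *\<^sub>R b) = 0"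
      using sum0 by (simp add: sum_negf)
    ultimately show ?thesis
      using that[of "\<lambda>b. - c b"] by blast
  qed
  define P where "P = {b \<in> B. d b > 0}"
  define w where "w = (\<Sum>b\<in>P. d b *\<^sub>R b)"
  have "(\<Sum>b\<in>B. d b *\<^sub>R b) = w + (\<Sum>b\<in>B - P. d b *\<^sub>R b)"
    unfolding w_def using fin by (subst sum.subset_diff[of P B]) (auto simp: P_def)
  then have "w = (\<Sum>b\<in>B - P. (- d b) *\<^sub>R b)"
    using d by (simp add: sum_negf eq_neg_iff_add_eq_0)
  then have "w \<bullet> w = (\<Sum>a\<in>P. d a *\<^sub>R a) \<bullet> (\<Sum>b\<in>B - P. (- d b) *\<^sub>R b)"
    unfolding w_def by simp
  also have "\<dots> = (\<Sum>b\<in>B - P. \<Sum>a\<in>P. d a * (- d b) * (a \<bullet> b))"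
    by (simp add: inner_sum_left inner_sum_right sum_distrib_left sum_negf mult_ac)
  also have "\<dots> \<le> 0"
  proof (intro sum_nonpos)
    fix a b assume ab: "a \<in> P" "b \<in> B - P"
    then have "a \<bullet> b < 0"
      by (intro negB) (auto simp: P_def)
    then show "d a * (- d b) * (a \<bullet> b) \<le> 0"
      using ab by (intro mult_nonneg_nonpos mult_nonneg_nonneg) (auto simp: P_def)
  qed
  finally have "w = 0"
    by (metis inner_eq_zero_iff inner_ge_zero order_antisym)
  moreover have "w \<bullet> p k < 0"
  proof -
    have "w \<bullet> p k = (\<Sum>b\<in>P. d b * (b \<bullet> p k))"
      by (simp add: w_def inner_sum_left)
    moreover have "0 < (\<Sum>b\<in>P. - (d b * (b \<bullet> p k)))"
      using fin \<open>v \<in> B\<close> dv negk by (intro sum_pos) (auto simp: P_def mult_pos_neg)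
    ultimately show ?thesis
      by (simp add: sum_negf)
  qed
  ultimately show False
    by simp
qed

text \<open>
  If all inner products were equal to \<open>1/2\<close>, the projection of \<open>e\<close> to the span of \<open>T\<close> would be
  proportional to the combination \<open>v\<close> used in the proof; Cauchy-Schwarz is applied to \<open>e\<close> and \<open>v\<close>.
  The last assumption makes the coefficients of \<open>v\<close> nonnegative.
\<close>

lemma cap_heights_constraint:
  fixes e :: "'a::real_inner"
  assumes "finite T" and T: "T \<subseteq> sphere 0 1" and e: "norm e = 1"
    and sep: "\<And>x y. x \<in> T \<Longrightarrow> y \<in> T \<Longrightarrow> x \<noteq> y \<Longrightarrow> x \<bullet> y \<le> 1 / 2"
    and weights: "\<And>y. y \<in> T \<Longrightarrow> (\<Sum>z\<in>T. e \<bullet> z) \<le> (real (card T) + 1) * (e \<bullet> y)"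
  shows "(real (card T) + 1) * (\<Sum>y\<in>T. (e \<bullet> y)\<^sup>2) - (\<Sum>y\<in>T. e \<bullet> y)\<^sup>2 \<le> (real (card T) + 1) / 2"
proof -
  define m where "m = real (card T) + 1"
  define \<sigma> where "\<sigma> = (\<Sum>y\<in>T. e \<bullet> y)"
  define q where "q = (\<Sum>y\<in>T. (e \<bullet> y)\<^sup>2)"
  \<comment> \<open>If all inner products of distinct points were 1/2, the Gram matrix would be (I +
    J)/2, with J the all-ones matrix, and inverse 2 (I - J/m); \<open>w\<close> is proportional to
    this inverse applied to the heights.\<close>
  define w where "w y = m * (e \<bullet> y) - \<sigma>" for y
  define v where "v = (\<Sum>y\<in>T. w y *\<^sub>R y)"
  have w0: "0 \<le> w y" if "y \<in> T" for y
    using weights[OF that] by (simp add: w_def m_def \<sigma>_def)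
  have card: "real (card T) = m - 1"
    by (simp add: m_def)
  have "e \<bullet> v = (\<Sum>y\<in>T. m * (e \<bullet> y)\<^sup>2 - \<sigma> * (e \<bullet> y))"
    by (simp add: v_def inner_sum_right w_def algebra_simps power2_eq_square)
  also have "\<dots> = m * q - \<sigma>\<^sup>2"
    by (simp add: sum_subtractf q_def \<sigma>_def sum_distrib_left power2_eq_square)
  finally have ev: "e \<bullet> v = m * q - \<sigma>\<^sup>2" .
  have sw: "sum w T = \<sigma>"
    by (simp add: w_def sum_subtractf sum_distrib_left[symmetric] \<sigma>_def[symmetric] card algebra_simps)
  have "(\<Sum>y\<in>T. (w y)\<^sup>2) = (\<Sum>y\<in>T. m\<^sup>2 * (e \<bullet> y)\<^sup>2 - 2 * m * \<sigma> * (e \<bullet> y) + \<sigma>\<^sup>2)"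
    by (simp add: w_def power2_eq_square algebra_simps)
  also have "\<dots> = m\<^sup>2 * q - (m + 1) * \<sigma>\<^sup>2"
    unfolding sum.distrib sum_subtractf sum_distrib_left[symmetric] q_def[symmetric] \<sigma>_def[symmetric]
      sum_constant card
    by (simp add: algebra_simps power2_eq_square)
  finally have sw2: "(\<Sum>y\<in>T. (w y)\<^sup>2) = m\<^sup>2 * q - (m + 1) * \<sigma>\<^sup>2" .
  have "v \<bullet> v = (\<Sum>x\<in>T. \<Sum>y\<in>T. w x * w y * (x \<bullet> y))"
    by (simp add: v_def inner_sum_left inner_sum_right sum_distrib_left mult_ac inner_commute)
  \<comment> \<open>Diagonal entries are 1 rather than at most 1/2; the extra term accounts for the
    difference.\<close>
  also have "\<dots> \<le> (\<Sum>x\<in>T. \<Sum>y\<in>T. w x * w y / 2 + (if x = y then (w x)\<^sup>2 / 2 else 0))"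
  proof (intro sum_mono)
    fix x y assume xy: "x \<in> T" "y \<in> T"
    show "w x * w y * (x \<bullet> y) \<le> w x * w y / 2 + (if x = y then (w x)\<^sup>2 / 2 else 0)"
    proof (cases "x = y")
      case True
      then show ?thesis
        using T xy by (auto simp: dot_square_norm power2_eq_square subset_iff)
    next
      case False
      have "w x * w y * (x \<bullet> y) \<le> w x * w y * (1 / 2)"
        using sep[OF xy False] w0 xy by (intro mult_left_mono) auto
      then show ?thesis
        using False by simp
    qed
  qed
  also have "\<dots> = (sum w T)\<^sup>2 / 2 + (\<Sum>y\<in>T. (w y)\<^sup>2) / 2"
    using \<open>finite T\<close>
    by (simp add: sum.distrib power2_eq_square sum_product sum_divide_distrib)
  also have "\<dots> = m / 2 * (m * q - \<sigma>\<^sup>2)"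
    unfolding sw sw2 by (simp add: field_simps power2_eq_square)
  finally have "v \<bullet> v \<le> m / 2 * (e \<bullet> v)"
    unfolding ev .
  moreover have "(e \<bullet> v)\<^sup>2 \<le> v \<bullet> v"
    using Cauchy_Schwarz_ineq[of e v] e by (simp add: dot_square_norm)
  ultimately have "(e \<bullet> v) * (e \<bullet> v) \<le> m / 2 * (e \<bullet> v)"
    by (simp add: power2_eq_square)
  \<comment> \<open>Cancel \<open>e \<bullet> v\<close> if it is positive; otherwise the bound is
    trivial.\<close>
  then have "e \<bullet> v \<le> m / 2"
    using mult_right_le_imp_le[of "e \<bullet> v" "e \<bullet> v" "m / 2"] by (cases "e \<bullet> v > 0") (auto simp: m_def)
  then show ?thesis
    unfolding ev by (simp add: m_def q_def \<sigma>_def)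
qed

lemma cap_card_le_3:
  fixes x :: "real^3"
  assumes "finite T" and x: "norm x = 1"
    and cap: "\<And>y. y \<in> T \<Longrightarrow> x \<bullet> y < - 708 / 1000"
    and sep: "\<And>y z. y \<in> T \<Longrightarrow> z \<in> T \<Longrightarrow> y \<noteq> z \<Longrightarrow> y \<bullet> z \<le> 1 / 2"
  shows "card T \<le> 3"
proof -
  define p where "p y = y - (x \<bullet> y) *\<^sub>R x" for y
  have xx: "x \<bullet> x = 1"
    using x by (simp add: dot_square_norm)
  have "card T \<le> DIM(real^3)"
  proof (rule card_pairwise_negative_orthogonal_le[OF \<open>finite T\<close>, of x p])
    show "x \<noteq> 0"
      using x by auto
    show "x \<bullet> p y = 0" for y
      by (simp add: p_def inner_diff_right xx)
    show "p y \<bullet> p z < 0" if "y \<in> T" "z \<in> T" "y \<noteq> z" for y z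
    proof -
      have "p y \<bullet> p z = y \<bullet> z - (- (x \<bullet> y)) * (- (x \<bullet> z))"
        by (simp add: p_def inner_diff_left inner_diff_right xx inner_commute)
      moreover have "708 / 1000 * (708 / 1000) \<le> (- (x \<bullet> y)) * (- (x \<bullet> z))"
        using cap[OF that(1)] cap[OF that(2)] by (intro mult_mono) auto
      ultimately show ?thesis
        using sep[OF that] by simp
    qed
  qed
  then show ?thesis
    by simp
qed

section \<open>Bounds for sums over a cap\<close>

lemma delsarte_poly_cap_pair:
  assumes a: "708 / 1000 \<le> a" "a \<le> 1" and b: "708 / 1000 \<le> b" "b \<le> 1"
    and ab: "3 * (a\<^sup>2 + b\<^sup>2) - (a + b)\<^sup>2 \<le> 3 / 2"
  shows "delsarte_poly (- a) + delsarte_poly (- b) \<le> 2564 / 1000"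
proof -
  define x where "x = (a + b) / 2 - 17 / 20"
  define e where "e = (a - b) / 2"
  have ab_eq: "a = x + 17 / 20 + e" "b = x + 17 / 20 - e"
    by (simp_all add: x_def e_def field_simps)
  have x0: "- 15 / 100 \<le> x"
    unfolding x_def using a b by (simp add: field_simps)
  have "delsarte_poly (- a) + delsarte_poly (- b) \<le>
      (1109 / 1000 + 1028 / 100 * (a - 17 / 20) + 185 / 10 * (a - 17 / 20)^2 + 73 / 10 * (a - 17 / 20)^3) +
      (1109 / 1000 + 1028 / 100 * (b - 17 / 20) + 185 / 10 * (b - 17 / 20)^2 + 73 / 10 * (b - 17 / 20)^3)"
    using a b by (intro add_mono delsarte_poly_cap_le_cubic)
  \<comment> \<open>In terms of the centered mean \<open>x\<close> and the half difference
    \<open>e\<close>, odd powers of \<open>e\<close> cancel.\<close>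
  also have "\<dots> = 2 * (1109 / 1000 + 1028 / 100 * x + 185 / 10 * x^2 + 73 / 10 * x^3) + (37 + 438 / 10 * x) * e\<^sup>2"
    unfolding ab_eq by algebra
  also have "(37 + 438 / 10 * x) * e\<^sup>2 \<le> (37 + 438 / 10 * x) * ((3 / 4 - (x + 17 / 20)\<^sup>2) / 3)"
  proof (rule mult_left_mono)
    have "3 * (a\<^sup>2 + b\<^sup>2) - (a + b)\<^sup>2 = 2 * (x + 17 / 20)\<^sup>2 + 6 * e\<^sup>2"
      unfolding ab_eq by algebra
    then show "e\<^sup>2 \<le> (3 / 4 - (x + 17 / 20)\<^sup>2) / 3"
      using ab by simp
  qed (use x0 in simp)
  \<comment> \<open>The cubic terms cancel, and what remains stays near 2.557 for the small values
    of \<open>x\<close> that occur.\<close>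
  also have "2 * (1109 / 1000 + 1028 / 100 * x + 185 / 10 * x^2 + 73 / 10 * x^3) +
      (37 + 438 / 10 * x) * ((3 / 4 - (x + 17 / 20)\<^sup>2) / 3)
    = 15343 / 6000 - 31 / 6000 * x - 23 / 150 * x\<^sup>2"
    by algebra
  also have "\<dots> \<le> 2564 / 1000"
    using x0 zero_le_power2[of x] by linarith
  finally show ?thesis
    by simp
qed

lemma delsarte_poly_cap_triple:
  assumes a: "708 / 1000 \<le> a" "a \<le> 1" and b: "708 / 1000 \<le> b" "b \<le> 1" and c: "708 / 1000 \<le> c" "c \<le> 1"
    and abc: "4 * (a\<^sup>2 + b\<^sup>2 + c\<^sup>2) - (a + b + c)\<^sup>2 \<le> 2"
  shows "delsarte_poly (- a) + delsarte_poly (- b) + delsarte_poly (- c) \<le> 2564 / 1000"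
proof -
  define s where "s = a + b + c"
  have s0: "2124 / 1000 \<le> s"
    using a b c by (simp add: s_def)
  have "3 * (a\<^sup>2 + b\<^sup>2 + c\<^sup>2) - s\<^sup>2 = (a - b)\<^sup>2 + (b - c)\<^sup>2 + (a - c)\<^sup>2"
    unfolding s_def by algebra
  then have "s\<^sup>2 \<le> 3 * (a\<^sup>2 + b\<^sup>2 + c\<^sup>2)"
    by (metis add_nonneg_nonneg diff_ge_0_iff_ge zero_le_power2)
  \<comment> \<open>The two inequalities give s^2 <= 6, and 2.45 lies just above the square root of
    6.\<close>
  then have "s\<^sup>2 \<le> (245 / 100)\<^sup>2"
    using abc by (simp add: s_def[symmetric] power2_eq_square)
  then have s1: "s \<le> 245 / 100"
    by (rule power2_le_imp_le) simp
  have "delsarte_poly (- a) + delsarte_poly (- b) + delsarte_poly (- c) \<le>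
      (1173 / 1000 + 997 / 100 * (a - 17 / 20) + 1212 / 100 * (a - 17 / 20)^2) +
      (1173 / 1000 + 997 / 100 * (b - 17 / 20) + 1212 / 100 * (b - 17 / 20)^2) +
      (1173 / 1000 + 997 / 100 * (c - 17 / 20) + 1212 / 100 * (c - 17 / 20)^2)"
    using a b c by (intro add_mono delsarte_poly_cap_le_quadratic)
  also have "\<dots> = 43656 / 10000 - 10634 / 1000 * s + 1212 / 100 * (a\<^sup>2 + b\<^sup>2 + c\<^sup>2)"
    unfolding s_def by algebra
  also have "\<dots> \<le> 43656 / 10000 - 10634 / 1000 * s + 1212 / 100 * ((2 + s\<^sup>2) / 4)"
    using abc by (simp add: s_def)
  also have "\<dots> \<le> 2564 / 1000"
  proof -
    \<comment> \<open>The bound to be shown is a convex quadratic in \<open>s\<close>. Subtracting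
      3.03 times this product, which is nonpositive between the two limits for \<open>s\<close>,
      leaves a linear inequality that follows from \<open>s1\<close>.\<close>
    have "s\<^sup>2 - 4574 / 1000 * s + 52038 / 10000 = (s - 2124 / 1000) * (s - 245 / 100)"
      by algebra
    also have "\<dots> \<le> 0"
      using s0 s1 by (intro mult_nonneg_nonpos) auto
    finally show ?thesis
      using s1 by (simp add: field_simps)
  qed
  finally show ?thesis .
qed

lemma delsarte_poly_cap_sum:
  fixes x :: "real^3"
  assumes "finite T" and x: "norm x = 1" and T: "T \<subseteq> sphere 0 1"
    and cap: "\<And>y. y \<in> T \<Longrightarrow> x \<bullet> y < - 708 / 1000"
    and sep: "\<And>y z. y \<in> T \<Longrightarrow> z \<in> T \<Longrightarrow> y \<noteq> z \<Longrightarrow> y \<bullet> z \<le> 1 / 2"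
  shows "(\<Sum>y\<in>T. delsarte_poly (x \<bullet> y)) \<le> 2564 / 1000"
proof -
  define s where "s y = - x \<bullet> y" for y
  have s: "708 / 1000 \<le> s y" "s y \<le> 1" if "y \<in> T" for y
  proof -
    show "708 / 1000 \<le> s y"
      using cap[OF that] by (simp add: s_def)
    have "norm y = 1"
      using T that by auto
    then show "s y \<le> 1"
      using norm_cauchy_schwarz[of "- x" y] x by (simp add: s_def)
  qed
  have f: "delsarte_poly (x \<bullet> y) = delsarte_poly (- s y)" for y
    by (simp add: s_def)
  have card: "card T \<le> 3"
    using assms(1) x cap sep by (rule cap_card_le_3)
  have constraint: "(real (card T) + 1) * (\<Sum>y\<in>T. (s y)\<^sup>2) - (\<Sum>y\<in>T. s y)\<^sup>2 \<le> (real (card T) + 1) / 2"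
    unfolding s_def
  proof (rule cap_heights_constraint[OF assms(1) T _ sep])
    show "norm (- x) = 1"
      using x by simp
    show "(\<Sum>z\<in>T. - x \<bullet> z) \<le> (real (card T) + 1) * (- x \<bullet> y)" if y: "y \<in> T" for y
    proof -
      have "(\<Sum>z\<in>T. s z) = s y + (\<Sum>z\<in>T - {y}. s z)"
        using assms(1) y by (rule sum.remove)
      also have "(\<Sum>z\<in>T - {y}. s z) \<le> (\<Sum>z\<in>T - {y}. 1)"
        using s by (intro sum_mono) auto
      also have "(\<Sum>z\<in>T - {y}. 1) = real (card T) - 1"
        unfolding card_Suc_Diff1[OF assms(1) y, symmetric] by simp
      \<comment> \<open>Here the bound of three points matters: k - 1 <= 0.708 k holds for k = 3 but
        fails for k = 4.\<close>
      also have "real (card T) - 1 \<le> real (card T) * (708 / 1000)"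
        using card by simp
      also have "\<dots> \<le> real (card T) * s y"
        using s y by (intro mult_left_mono) auto
      finally show ?thesis
        by (simp add: s_def algebra_simps)
    qed
  qed
  consider "card T = 0" | "card T = 1" | "card T = 2" | "card T = 3"
    using card by linarith
  then show ?thesis
  proof cases
    case 1
    then show ?thesis
      using assms(1) by simp
  next
    case 2
    then obtain a where "T = {a}"
      by (rule card_1_singletonE)
    then show ?thesis
      using delsarte_poly_cap_le_const[of "s a"] s by (simp add: f)
  next
    case 3
    then obtain a b where T': "T = {a, b}" "a \<noteq> b"
      by (auto simp: card_2_iff)
    then show ?thesis
      using delsarte_poly_cap_pair[of "s a" "s b"] s constraint by (simp add: f)
  next
    case 4
    then obtain a b c where T': "T = {a, b, c}" "a \<noteq> b" "a \<noteq> c" "b \<noteq> c"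
      by (auto simp: card_3_iff)
    then show ?thesis
      using delsarte_poly_cap_triple[of "s a" "s b" "s c"] s constraint by (simp add: f add.assoc)
  qed
qed

section \<open>Kissing configurations in three dimensions\<close>

lemma kissing_config_inner_le:
  assumes "kissing_config S" "x \<in> S" "y \<in> S" "x \<noteq> y"
  shows "x \<bullet> y \<le> 1 / 2"
proof -
  have "norm x = 1" "norm y = 1"
    using assms by (auto simp: kissing_config_def)
  then have "\<bar>x \<bullet> y\<bar> \<le> 1"
    using Cauchy_Schwarz_ineq2[of x y] by simp
  moreover have "pi / 3 \<le> arccos (x \<bullet> y)"
    using assms by (auto simp: kissing_config_def sph_dist_def)
  ultimately have "cos (arccos (x \<bullet> y)) \<le> cos (pi / 3)"
    by (intro cos_monotone_0_pi_le) (auto simp: arccos_ubound abs_le_iff)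
  then show ?thesis
    using \<open>\<bar>x \<bullet> y\<bar> \<le> 1\<close> by (simp add: cos_60 cos_arccos_abs)
qed

lemma kissing_config_delsarte_poly_sum:
  fixes S :: "(real^3) set"
  assumes S: "kissing_config S" and x: "x \<in> S"
  shows "(\<Sum>y\<in>S. delsarte_poly (x \<bullet> y)) \<le> 12999 / 1000"
proof -
  have fin: "finite S" and sph: "S \<subseteq> sphere 0 1"
    using S by (auto simp: kissing_config_def)
  have nx: "norm x = 1"
    using sph x by auto
  define T where "T = {y \<in> S - {x}. x \<bullet> y < - 708 / 1000}"
  have "(\<Sum>y\<in>S. delsarte_poly (x \<bullet> y)) = delsarte_poly (x \<bullet> x) + (\<Sum>y\<in>S - {x}. delsarte_poly (x \<bullet> y))"
    using fin x by (rule sum.remove)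
  also have "(\<Sum>y\<in>S - {x}. delsarte_poly (x \<bullet> y)) =
      (\<Sum>y\<in>S - {x} - T. delsarte_poly (x \<bullet> y)) + (\<Sum>y\<in>T. delsarte_poly (x \<bullet> y))"
    using fin by (intro sum.subset_diff) (auto simp: T_def)
  also have "(\<Sum>y\<in>S - {x} - T. delsarte_poly (x \<bullet> y)) \<le> 0"
    using kissing_config_inner_le[OF S x] by (intro sum_nonpos delsarte_poly_nonpos) (auto simp: T_def)
  also have "(\<Sum>y\<in>T. delsarte_poly (x \<bullet> y)) \<le> 2564 / 1000"
    using kissing_config_inner_le[OF S] fin sph nx by (intro delsarte_poly_cap_sum) (auto simp: T_def)
  \<comment> \<open>The point \<open>x\<close> itself contributes 10.435, and 10.435 + 2.564 =
    12.999.\<close>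
  finally show ?thesis
    using nx by (simp add: dot_square_norm delsarte_poly_1)
qed

lemma kissing_config_card_le:
  fixes S :: "(real^3) set"
  assumes "kissing_config S"
  shows "card S \<le> 12"
proof (cases "S = {}")
  case False
  have fin: "finite S" and sph: "S \<subseteq> sphere 0 1"
    using assms by (auto simp: kissing_config_def)
  have "(real (card S))\<^sup>2 \<le> (\<Sum>x\<in>S. \<Sum>y\<in>S. delsarte_poly (x \<bullet> y))"
    using fin sph by (rule delsarte_poly_kernel)
  also have "\<dots> \<le> (\<Sum>x\<in>S. 12999 / 1000)"
    by (intro sum_mono kissing_config_delsarte_poly_sum assms)
  finally have "real (card S) * real (card S) \<le> real (card S) * (12999 / 1000)"
    by (simp add: power2_eq_square)
  moreover have "0 < real (card S)"
    using False fin by (simp add: card_gt_0_iff)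
  ultimately have "real (card S) \<le> 12999 / 1000"
    by (simp only: mult_le_cancel_left_pos)
  then show ?thesis
    by linarith
qed simp

section \<open>Lower bound: twelve points\<close>

text \<open>The minimal vectors of the face-centered cubic lattice, that is, the vertices of a
  cuboctahedron. Integer coordinates let the simplifier check all pairs.\<close>

definition fcc_roots :: "(int \<times> int \<times> int) set" where
  "fcc_roots = {(1, 1, 0), (1, -1, 0), (-1, 1, 0), (-1, -1, 0), (1, 0, 1), (1, 0, -1), (-1, 0, 1), (-1, 0, -1),
     (0, 1, 1), (0, 1, -1), (0, -1, 1), (0, -1, -1)}"

lemma kissing_config_12: "\<exists>S :: (real^3) set. kissing_config S \<and> card S = 12"
proof (intro exI conjI)
  define v :: "int \<times> int \<times> int \<Rightarrow> real^3" where
    "v = (\<lambda>(a, b, c). (1 / sqrt 2) *\<^sub>R vector [of_int a, of_int b, of_int c])"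
  \<comment> \<open>The roots have squared length 2, and distinct ones have integer inner product at
    most 1; the scaling halves both.\<close>
  have inner: "v (a, b, c) \<bullet> v (a', b', c') = of_int (a * a' + b * b' + c * c') / 2" for a b c a' b' c'
    by (simp add: v_def inner_vec_def sum_3 vector_3 field_simps)
  have "inj v"
    by (auto simp: inj_on_def v_def vec_eq_iff forall_3 vector_3)
  moreover have "card fcc_roots = 12"
    by (simp add: fcc_roots_def)
  ultimately show "card (v ` fcc_roots) = 12"
    by (metis card_image inj_on_subset subset_UNIV)
  have norm: "norm (v p) = 1" if "p \<in> fcc_roots" for p
    using that by (auto simp: fcc_roots_def norm_eq_1 inner)
  have sep: "v p \<bullet> v q \<le> 1 / 2" if "p \<in> fcc_roots" "q \<in> fcc_roots" "p \<noteq> q" for p q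
    using that by (auto simp: fcc_roots_def inner)
  have dist: "pi / 3 \<le> arccos (v p \<bullet> v q)" if "p \<in> fcc_roots" "q \<in> fcc_roots" "p \<noteq> q" for p q
  proof -
    have "\<bar>v p \<bullet> v q\<bar> \<le> 1"
      using Cauchy_Schwarz_ineq2[of "v p" "v q"] norm that by simp
    then have "arccos (1 / 2) \<le> arccos (v p \<bullet> v q)"
      using sep[OF that] by (intro arccos_le_mono[THEN iffD2]) auto
    then show ?thesis
      using arccos_cos[of "pi / 3"] by (simp add: cos_60)
  qed
  show "kissing_config (v ` fcc_roots)"
    unfolding kissing_config_def sph_dist_def
  proof (intro conjI)
    show "finite (v ` fcc_roots)"
      by (simp add: fcc_roots_def)
    show "v ` fcc_roots \<subseteq> sphere 0 1"
      using norm by auto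
    show "\<forall>x\<in>v ` fcc_roots. \<forall>y\<in>v ` fcc_roots. x \<noteq> y \<longrightarrow> pi / 3 \<le> arccos (x \<bullet> y)"
      using dist by blast
  qed
qed

theorem mainTheorem1:
  shows "kissing_number TYPE(real^3) = 12"
  unfolding kissing_number_def
proof (rule Max_eqI)
  \<comment> \<open>\<open>Max\<close> is characterized only on finite sets, so the upper bound is
    used first to get finiteness.\<close>
  have "{card S |S :: (real^3) set. kissing_config S} \<subseteq> {..12}"
    using kissing_config_card_le by auto
  then show "finite {card S |S :: (real^3) set. kissing_config S}"
    by (rule finite_subset) simp
  show "n \<le> 12" if "n \<in> {card S |S :: (real^3) set. kissing_config S}" for n
    using that kissing_config_card_le by auto
  show "12 \<in> {card S |S :: (real^3) set. kissing_config S}"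
    using kissing_config_12 by (auto simp: eq_commute)
qed

end
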